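(* Let $\Omega\subset\mathbb{C}$ be a bounded domain and let $\varphi$ be a non-constant analytic self-map of $\Omega$ (that is, $\varphi\in\mathcal{H}(\Omega)$ and $\varphi(\Omega)\subset\Omega$) with the property that $d(\varphi(z),\partial\Omega)\to0$ whenever $d(z,\partial\Omega)\to0$. Then $\varphi(\Omega)=\Omega$.
   Context: A domain is an open connected subset of $\mathbb{C}$; no further connectivity assumption is made. $\mathcal{H}(\Omega)$ is the set of analytic functions on $\Omega$, and $d(z,\partial\Omega)$ denotes the Euclidean distance from $z$ to the boundary of $\Omega$. The property means: for every sequence $(z_n)$ in $\Omega$ with $d(z_n,\partial\Omega)\to0$ one has $d(\varphi(z_n),\partial\Omega)\to0$. *)

theory Defs
  imports "HOL-Complex_Analysis.Complex_Analysis"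
begin

end

theory Submission
  imports Defs
begin

text \<open>
  The image \<open>\<phi> ` \<Omega>\<close> is a nonempty subset of the connected set \<open>\<Omega>\<close>, so it is enough that it
  be both open and relatively closed. Openness is the open mapping theorem, and is the only place
  where more than continuity is used. Relative closedness
  (\<open>closedin_image_of_boundary_preserving\<close>) is a properness argument: a map that carries
  sequences approaching the boundary to sequences approaching the boundary cannot have a limit of
  its values inside \<open>\<Omega>\<close> unless the arguments accumulate inside \<open>\<Omega>\<close>, and there continuity
  identifies the limit as a value.
\<close>

text \<open>
  Boundedness makes the preimages of a convergent sequence of values subconverge in the closure
  of \<open>S\<close>. A limit on the frontier would push the limit of the values onto the frontier as well,
  which an open set does not meet; so the limit lies in \<open>S\<close>.
\<close>

lemma closedin_image_of_boundary_preserving: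
  fixes S :: "'a::heine_borel set" and f :: "'a \<Rightarrow> 'a"
  assumes "open S" and "bounded S" and cont: "continuous_on S f" and sub: "f ` S \<subseteq> S"
    and boundary: "\<And>z :: nat \<Rightarrow> 'a. (\<And>n. z n \<in> S) \<Longrightarrow>
           (\<lambda>n. infdist (z n) (frontier S)) \<longlonglongrightarrow> 0 \<Longrightarrow>
           (\<lambda>n. infdist (f (z n)) (frontier S)) \<longlonglongrightarrow> 0"
  shows "closedin (top_of_set S) (f ` S)"
proof -
  have "w \<in> f ` S" if w: "w \<in> S" "w \<in> closure (f ` S)" for w
  proof -
    obtain v where v: "\<And>n. v n \<in> f ` S" and v_lim: "v \<longlonglongrightarrow> w"
      using w(2) unfolding closure_sequential by blast
    obtain z where z: "\<And>n. z n \<in> S" and fz: "\<And>n. f (z n) = v n"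
      using v unfolding image_iff by metis
    have "compact (closure S)"
      using \<open>bounded S\<close> by (simp add: compact_closure)
    moreover have "\<forall>n. z n \<in> closure S"
      using z closure_subset by blast
    ultimately obtain a r where a: "a \<in> closure S" and r: "strict_mono (r :: nat \<Rightarrow> nat)"
      and z_lim: "(z \<circ> r) \<longlonglongrightarrow> a"
      unfolding compact_def by metis
    have fzr: "(\<lambda>n. f ((z \<circ> r) n)) \<longlonglongrightarrow> w"
      using LIMSEQ_subseq_LIMSEQ[OF v_lim r] by (simp add: fz o_def)
    have "a \<in> S"
    proof (rule ccontr)
      assume "a \<notin> S"
      then have a_frontier: "a \<in> frontier S"
        using a \<open>open S\<close> by (simp add: frontier_def interior_open)
      have "(\<lambda>n. infdist ((z \<circ> r) n) (frontier S)) \<longlonglongrightarrow> infdist a (frontier S)"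
        by (rule tendsto_infdist[OF z_lim])
      then have "(\<lambda>n. infdist (f ((z \<circ> r) n)) (frontier S)) \<longlonglongrightarrow> 0"
        using z a_frontier by (intro boundary) auto
      moreover have "(\<lambda>n. infdist (f ((z \<circ> r) n)) (frontier S)) \<longlonglongrightarrow> infdist w (frontier S)"
        by (rule tendsto_infdist[OF fzr])
      ultimately have "infdist w (frontier S) = 0"
        using LIMSEQ_unique by blast
      \<comment> \<open>The distance to an empty set is 0 by convention, hence the appeal to \<open>a_frontier\<close>.\<close>
      then have "w \<in> frontier S"
        using a_frontier in_closed_iff_infdist_zero[OF frontier_closed, of S w] by blast
      then show False
        using w(1) \<open>open S\<close> by (simp add: frontier_def interior_open)
    qed
    then have "(\<lambda>n. f ((z \<circ> r) n)) \<longlonglongrightarrow> f a"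
      using z by (intro continuous_on_tendsto_compose[OF cont z_lim]) auto
    then have "w = f a"
      using fzr LIMSEQ_unique by blast
    with \<open>a \<in> S\<close> show ?thesis by blast
  qed
  then have "f ` S = S \<inter> closure (f ` S)"
    using sub closure_subset[of "f ` S"] by blast
  then show ?thesis
    by (metis closedin_closed_Int closed_closure)
qed

theorem theorem7:
  fixes \<Omega> :: "complex set" and \<phi> :: "complex \<Rightarrow> complex"
  assumes "open \<Omega>" and "connected \<Omega>" and "bounded \<Omega>"
    and "\<phi> analytic_on \<Omega>"
    and "\<phi> ` \<Omega> \<subseteq> \<Omega>"
    and "\<not> \<phi> constant_on \<Omega>"
    and "\<And>z :: nat \<Rightarrow> complex.
           (\<And>n. z n \<in> \<Omega>) \<Longrightarrow>
           (\<lambda>n. infdist (z n) (frontier \<Omega>)) \<longlonglongrightarrow> 0 \<Longrightarrow>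
           (\<lambda>n. infdist (\<phi> (z n)) (frontier \<Omega>)) \<longlonglongrightarrow> 0"
  shows "\<phi> ` \<Omega> = \<Omega>"
proof -
  have hol: "\<phi> holomorphic_on \<Omega>"
    using assms(4) by (rule analytic_imp_holomorphic)
  have "open (\<phi> ` \<Omega>)"
    using open_mapping_thm[OF hol assms(1,2,1) order_refl assms(6)] .
  then have "openin (top_of_set \<Omega>) (\<phi> ` \<Omega>)"
    using assms(5) by (simp add: open_subset)
  moreover have "closedin (top_of_set \<Omega>) (\<phi> ` \<Omega>)"
    using closedin_image_of_boundary_preserving[OF assms(1,3) holomorphic_on_imp_continuous_on[OF hol]
        assms(5,7)] .
  moreover have "\<phi> ` \<Omega> \<noteq> {}"
    using assms(6) by (auto simp: constant_on_def)
  ultimately show ?thesis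
    using assms(2) unfolding connected_clopen by blast
qed

end
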